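(* Let $f:\mathbb{R}^n\to\mathbb{R}\cup\{+\infty\}$ be proper, lower semicontinuous and convex, and $A\in\mathbb{R}^{m\times n}$. The set of minimizers over $x\in\mathbb{R}^n$ of $f(x)+\frac12\|Ax-b\|^2$ is nonempty for every $b\in\mathbb{R}^m$ if and only if both of the following hold: (i) $\partial(A\triangleright f)$ is maximally monotone; (ii) $A\triangleright f$ is exact in $\operatorname{dom}\partial(A\triangleright f)$.
   Context: The infimal postcomposition of $f$ by $A$ is the (convex, possibly improper or non-closed) function $A\triangleright f:\mathbb{R}^m\to[-\infty,+\infty]$, $(A\triangleright f)(t)=\inf\{f(x):x\in\mathbb{R}^n,\ Ax=t\}$. It is exact at $t$ if this infimum is attained, i.e. there is $x$ with $Ax=t$ and $f(x)=(A\triangleright f)(t)$; it is exact in a set if it is exact at each point of that set. For $h:\mathbb{R}^m\to[-\infty,+\infty]$, $\partial h(t)=\{u:h(s)\ge h(t)+\langle u,s-t\rangle\ \forall s\}$ if $h(t)\in\mathbb{R}$, and $\partial h(t)=\varnothing$ otherwise; $\operatorname{dom}\partial h=\{t:\partial h(t)\neq\varnothing\}$. *)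

theory Defs
  imports "HOL-Analysis.Analysis"
begin

definition proper_fun :: "('a \<Rightarrow> ereal) \<Rightarrow> bool" where
  "proper_fun f \<longleftrightarrow> (\<forall>x. f x \<noteq> -\<infinity>) \<and> (\<exists>x. f x \<noteq> \<infinity>)"

definition lsc_fun :: "('a::topological_space \<Rightarrow> ereal) \<Rightarrow> bool" where
  "lsc_fun f \<longleftrightarrow> (\<forall>x. f x \<le> Liminf (at x) f)"

definition ereal_epigraph :: "('a \<Rightarrow> ereal) \<Rightarrow> ('a \<times> real) set" where
  "ereal_epigraph f = {(x, r). f x \<le> ereal r}"

text \<open>Convexity is stated through the epigraph, so that no convention for
  \<open>\<infinity> - \<infinity>\<close> in \<^typ>\<open>ereal\<close> is involved.\<close>

definition convex_fun :: "('a::real_vector \<Rightarrow> ereal) \<Rightarrow> bool" where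
  "convex_fun f \<longleftrightarrow> convex (ereal_epigraph f)"

text \<open>The infimum over an empty fibre is \<open>\<infinity>\<close>.\<close>

definition infimal_postcomp ::
    "real^'n^'m \<Rightarrow> (real^'n \<Rightarrow> ereal) \<Rightarrow> real^'m \<Rightarrow> ereal"  (infixr \<open>\<triangleright>\<close> 75) where
  "(A \<triangleright> f) t = (INF x\<in>{x. A *v x = t}. f x)"

definition exact_at :: "real^'n^'m \<Rightarrow> (real^'n \<Rightarrow> ereal) \<Rightarrow> real^'m \<Rightarrow> bool" where
  "exact_at A f t \<longleftrightarrow> (\<exists>x. A *v x = t \<and> f x = (A \<triangleright> f) t)"

definition exact_in :: "real^'n^'m \<Rightarrow> (real^'n \<Rightarrow> ereal) \<Rightarrow> (real^'m) set \<Rightarrow> bool" where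
  "exact_in A f T \<longleftrightarrow> (\<forall>t\<in>T. exact_at A f t)"

definition subdiff :: "('a::real_inner \<Rightarrow> ereal) \<Rightarrow> 'a \<Rightarrow> 'a set" where
  "subdiff h t =
    (if \<bar>h t\<bar> \<noteq> \<infinity> then {u. \<forall>s. h s \<ge> h t + ereal (u \<bullet> (s - t))} else {})"

definition op_dom :: "('a \<Rightarrow> 'b set) \<Rightarrow> 'a set" where
  "op_dom T = {t. T t \<noteq> {}}"

definition monotone_op :: "('a::real_inner \<Rightarrow> 'a set) \<Rightarrow> bool" where
  "monotone_op T \<longleftrightarrow> (\<forall>x y. \<forall>u\<in>T x. \<forall>v\<in>T y. (u - v) \<bullet> (x - y) \<ge> 0)"

text \<open>Maximality is with respect to inclusion of graphs, which is the pointwise order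
  \<open>\<forall>x. T x \<subseteq> S x\<close> on set-valued maps.\<close>

definition maximally_monotone :: "('a::real_inner \<Rightarrow> 'a set) \<Rightarrow> bool" where
  "maximally_monotone T \<longleftrightarrow>
    monotone_op T \<and> (\<forall>S. monotone_op S \<and> (\<forall>x. T x \<subseteq> S x) \<longrightarrow> S = T)"

definition minimizers :: "('a \<Rightarrow> ereal) \<Rightarrow> 'a set" where
  "minimizers g = {x. \<forall>y. g x \<le> g y}"

end

theory Submission
  imports Defs
begin

text \<open>
  Write \<open>h = A \<triangleright> f\<close>. Minimizing \<open>f(x) + 1/2 \<parallel>A x - b\<parallel>\<^sup>2\<close> over \<open>x\<close> amounts to minimizing
  \<open>h(t) + 1/2 \<parallel>t - b\<parallel>\<^sup>2\<close> over \<open>t\<close> and then finding an \<open>x\<close> in the fibre \<open>A x = t\<close> that attains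
  \<open>h(t)\<close>. The optimality condition of the problem in \<open>t\<close> is \<open>b - t \<in> \<partial>h(t)\<close>, so the claim is
  Minty's theorem (a monotone operator \<open>T\<close> is maximal iff \<open>b \<in> t + T(t)\<close> is solvable for
  every \<open>b\<close>) for \<open>T = \<partial>h\<close>, combined with attainment on the fibres that matter.

  If minimizers exist, each minimizer \<open>x\<close> yields \<open>b - A x \<in> \<partial>h(A x)\<close> and \<open>f(x) = h(A x)\<close>
  (\<open>subdiff_infimal_postcomp_minimizer\<close>), so \<open>b \<in> t + \<partial>h(t)\<close> is always solvable, and the
  elementary half of Minty's theorem gives (i). For (ii), given \<open>u \<in> \<partial>h(t)\<close> choose
  \<open>b = t + u\<close>: the solution of \<open>b - t \<in> \<partial>h(t)\<close> is unique, so the minimizer for this \<open>b\<close>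
  lies over \<open>t\<close> and attains \<open>h(t)\<close>.

  Conversely, the difficulty is that \<open>h\<close> need not be lower semicontinuous, so
  \<open>h + 1/2 \<parallel>\<cdot> - b\<parallel>\<^sup>2\<close> need not have a minimizer a priori. Replace \<open>h\<close> by the supremum \<open>k\<close> of its
  affine minorants that touch it. This function is closed and convex and agrees with \<open>h\<close>
  wherever \<open>h\<close> has a subgradient; \<open>k + 1/2 \<parallel>\<cdot> - b\<parallel>\<^sup>2\<close> has a minimizer \<open>t\<close> by compactness, and
  its optimality condition says that \<open>(t, b - t)\<close> is monotonically related to every pair in the
  graph of \<open>\<partial>h\<close>. Maximality puts \<open>(t, b - t)\<close> in that graph (\<open>subdiff_resolvent_exists\<close>), and
  exactness lifts \<open>t\<close> to a minimizer \<open>x\<close>.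
\<close>

section \<open>Resolvents of monotone operators\<close>

text \<open>The subtraction of the two inclusions gives \<open>- \<parallel>t - t'\<parallel>\<^sup>2 \<ge> 0\<close>: resolvents of monotone
  operators are single-valued.\<close>

lemma monotone_op_resolvent_unique:
  fixes t t' b :: "'a::real_inner"
  assumes "monotone_op T" "b - t \<in> T t" "b - t' \<in> T t'"
  shows "t = t'"
proof -
  have "((b - t) - (b - t')) \<bullet> (t - t') \<ge> 0"
    using assms unfolding monotone_op_def by blast
  moreover have "((b - t) - (b - t')) \<bullet> (t - t') = - ((t - t') \<bullet> (t - t'))"
    by (simp add: inner_diff)
  ultimately have "(t - t') \<bullet> (t - t') \<le> 0" by simp
  then have "(t - t') \<bullet> (t - t') = 0" by (intro antisym inner_ge_zero)
  then show ?thesis by simp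
qed

text \<open>The elementary half of Minty's theorem: if \<open>u\<close> is a value at \<open>t\<close> of a monotone extension,
  the solution of the inclusion for \<open>b = t + u\<close> must be \<open>t\<close> itself, so \<open>u\<close> was already present.\<close>

lemma maximally_monotone_if_resolvent_total:
  fixes T :: "'a::real_inner \<Rightarrow> 'a set"
  assumes mono: "monotone_op T" and total: "\<And>b. \<exists>t. b - t \<in> T t"
  shows "maximally_monotone T"
  unfolding maximally_monotone_def
proof (intro conjI allI impI)
  show "monotone_op T" by (rule mono)
next
  fix S assume S: "monotone_op S \<and> (\<forall>x. T x \<subseteq> S x)"
  show "S = T"
  proof (intro ext equalityI subsetI)
    fix t u assume u: "u \<in> S t"
    obtain t' where t': "(t + u) - t' \<in> T t'" using total by blast
    have "(t + u) - t \<in> S t" using u by simp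
    moreover have "(t + u) - t' \<in> S t'" using t' S by blast
    ultimately have "t = t'" using monotone_op_resolvent_unique S by blast
    then show "u \<in> T t" using t' by simp
  next
    fix t u assume "u \<in> T t" then show "u \<in> S t" using S by blast
  qed
qed

lemma maximally_monotone_related_mem:
  fixes T :: "'a::real_inner \<Rightarrow> 'a set"
  assumes max: "maximally_monotone T"
    and rel: "\<And>s u. u \<in> T s \<Longrightarrow> (v - u) \<bullet> (t - s) \<ge> 0"
  shows "v \<in> T t"
proof -
  define S where "S = T(t := insert v (T t))"
  have mono: "monotone_op T" using max by (simp add: maximally_monotone_def)
  have rel': "(u - v) \<bullet> (s - t) \<ge> 0" if "u \<in> T s" for s u
  proof -
    have "(u - v) \<bullet> (s - t) = (v - u) \<bullet> (t - s)" by (simp add: inner_diff)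
    then show ?thesis using rel[OF that] by simp
  qed
  have "monotone_op S"
    using mono rel rel' unfolding monotone_op_def S_def
    by (auto split: if_splits)
  moreover have "\<forall>x. T x \<subseteq> S x" by (auto simp: S_def)
  ultimately have "S = T" using max by (simp add: maximally_monotone_def)
  then show ?thesis by (metis S_def fun_upd_same insertI1)
qed

section \<open>Subdifferentials and proximal problems\<close>

lemma subdiff_iff:
  "u \<in> subdiff h t \<longleftrightarrow> (\<exists>c. h t = ereal c \<and> (\<forall>s. ereal (c + u \<bullet> (s - t)) \<le> h s))"
  by (cases "h t") (auto simp: subdiff_def)

lemma monotone_op_subdiff: "monotone_op (subdiff h)"
  unfolding monotone_op_def
proof (intro allI ballI)
  fix x y u v assume "u \<in> subdiff h x" "v \<in> subdiff h y"
  then obtain c d where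
    c: "h x = ereal c" "\<And>s. ereal (c + u \<bullet> (s - x)) \<le> h s" and
    d: "h y = ereal d" "\<And>s. ereal (d + v \<bullet> (s - y)) \<le> h s"
    by (auto simp: subdiff_iff)
  have "c + u \<bullet> (y - x) \<le> d" "d + v \<bullet> (x - y) \<le> c"
    using c(2)[of y] d(2)[of x] c(1) d(1) by auto
  then show "(u - v) \<bullet> (x - y) \<ge> 0" by (simp add: inner_diff)
qed

text \<open>The optimality condition of a proximal problem, with the epigraph replaced by a convex
  set \<open>C\<close>. It serves both for the image of the epigraph of \<open>f\<close> under \<open>A\<close> and for the
  epigraph of the supremum of touching affine minorants. Moving from \<open>(t, r)\<close> towards \<open>(s, c)\<close>
  by a fraction \<open>l\<close> changes the objective by
  \<open>l (c - r - (b - t) \<bullet> (s - t)) + l\<^sup>2/2 \<parallel>s - t\<parallel>\<^sup>2\<close>, which cannot be negative for small \<open>l\<close>.\<close>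

lemma prox_first_order:
  fixes C :: "('a::real_inner \<times> real) set"
  assumes conv: "convex C" and tr: "(t, r) \<in> C" and sc: "(s, c) \<in> C"
    and min: "\<And>s c. (s, c) \<in> C \<Longrightarrow>
      r + 1/2 * (norm (t - b))\<^sup>2 \<le> c + 1/2 * (norm (s - b))\<^sup>2"
  shows "r + (b - t) \<bullet> (s - t) \<le> c"
proof -
  define p where "p = c - r - (b - t) \<bullet> (s - t)"
  define q where "q = (s - t) \<bullet> (s - t)"
  have ineq: "0 \<le> p + l / 2 * q" if l: "0 < l" "l < 1" for l :: real
  proof -
    have "(1 - l) *\<^sub>R (t, r) + l *\<^sub>R (s, c) \<in> C"
      using conv tr sc l by (intro convexD) auto
    moreover have "(1 - l) *\<^sub>R (t, r) + l *\<^sub>R (s, c) = (t + l *\<^sub>R (s - t), r + l * (c - r))"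
      by (simp add: algebra_simps)
    ultimately have "(t + l *\<^sub>R (s - t), r + l * (c - r)) \<in> C" by simp
    from min[OF this]
    have "r + 1/2 * (norm (t - b))\<^sup>2
      \<le> r + l * (c - r) + 1/2 * (norm ((t - b) + l *\<^sub>R (s - t)))\<^sup>2"
      by (simp add: algebra_simps)
    also have "(norm ((t - b) + l *\<^sub>R (s - t)))\<^sup>2
      = (norm (t - b))\<^sup>2 + 2 * l * ((t - b) \<bullet> (s - t)) + l\<^sup>2 * q"
      by (simp only: power2_norm_eq_inner q_def)
        (simp add: inner_add inner_commute power2_eq_square algebra_simps)
    finally have "0 \<le> l * (c - r) + l * ((t - b) \<bullet> (s - t)) + 1/2 * (l\<^sup>2 * q)"
      by (simp add: algebra_simps)
    also have "\<dots> = l * (p + l / 2 * q)"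
      by (simp add: p_def power2_eq_square inner_diff_left algebra_simps)
    finally show ?thesis using l by (simp add: zero_le_mult_iff)
  qed
  have "((\<lambda>l. p + l / 2 * q) \<longlongrightarrow> p + 0 / 2 * q) (at_right 0)"
    by (intro tendsto_intros) simp
  moreover have "\<forall>\<^sub>F l in at_right (0::real). 0 \<le> p + l / 2 * q"
    using ineq by (auto simp: eventually_at_right_field intro!: exI[of _ 1])
  ultimately have "0 \<le> p + 0 / 2 * q"
    by (rule tendsto_lowerbound) simp
  then show ?thesis by (simp add: p_def)
qed

text \<open>The affine lower bound makes the objective coercive: completing the square in it leaves
  \<open>1/2 \<parallel>t - (b - u)\<parallel>\<^sup>2\<close> plus a constant, so sublevel sets are bounded.\<close>

lemma prox_minimizer_exists:
  fixes C :: "('a::euclidean_space \<times> real) set"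
  assumes cl: "closed C" and ne: "(t0, r0) \<in> C"
    and minorant: "\<And>t r. (t, r) \<in> C \<Longrightarrow> d + u \<bullet> t \<le> r"
  obtains t r where "(t, r) \<in> C"
    "\<And>s c. (s, c) \<in> C \<Longrightarrow> r + 1/2 * (norm (t - b))\<^sup>2 \<le> c + 1/2 * (norm (s - b))\<^sup>2"
proof -
  define F where "F = (\<lambda>z::'a \<times> real. snd z + 1/2 * (norm (fst z - b))\<^sup>2)"
  define M where "M = F (t0, r0)"
  define K where "K = C \<inter> {z. F z \<le> M}"
  have contF: "continuous_on UNIV F"
    unfolding F_def by (intro continuous_intros)
  have "closed {z. F z \<le> M}"
    using closed_Collect_le[OF contF continuous_on_const[of UNIV M]] by simp
  then have "closed K" unfolding K_def using cl by blast
  moreover have "bounded K"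
  proof -
    define R where "R = 2 * (M - d - u \<bullet> b + 1/2 * (u \<bullet> u))"
    define B where "B = norm (b - u) + (1 + R)"
    have *: "norm t \<le> B \<and> r \<in> {d - norm u * B .. M}" if "(t, r) \<in> K" for t r
    proof -
      have tr: "d + u \<bullet> t \<le> r" and M: "r + 1/2 * (norm (t - b))\<^sup>2 \<le> M"
        using that minorant by (auto simp: K_def F_def)
      have "(norm (t - (b - u)))\<^sup>2 = (norm (t - b))\<^sup>2 + 2 * (u \<bullet> t) - 2 * (u \<bullet> b) + u \<bullet> u"
        by (simp only: power2_norm_eq_inner)
          (simp add: inner_add inner_diff inner_commute algebra_simps)
      also have "\<dots> \<le> R" using tr M by (simp add: R_def)
      finally have le: "(norm (t - (b - u)))\<^sup>2 \<le> R" .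
      \<comment> \<open>\<open>1 + R\<close> is a crude substitute for \<open>sqrt R\<close>.\<close>
      have "R \<ge> 0" using le by (rule order_trans[OF zero_le_power2])
      then have "R \<le> (1 + R)\<^sup>2" by (simp add: power2_eq_square algebra_simps)
      with le have "(norm (t - (b - u)))\<^sup>2 \<le> (1 + R)\<^sup>2" by (rule order_trans)
      then have "norm (t - (b - u)) \<le> 1 + R"
        by (rule power2_le_imp_le) (use \<open>R \<ge> 0\<close> in simp)
      then have t: "norm t \<le> B"
        using norm_triangle_sub[of t "b - u"] by (simp add: B_def)
      have "- (u \<bullet> t) \<le> norm u * norm t"
        using Cauchy_Schwarz_ineq2[of u t] by linarith
      also have "\<dots> \<le> norm u * B" using t by (intro mult_left_mono) auto
      finally have "d - norm u * B \<le> r" using tr by linarith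
      moreover have "r \<le> M" using M zero_le_power2[of "norm (t - b)"] by linarith
      ultimately show ?thesis using t by simp
    qed
    have "K \<subseteq> cball 0 B \<times> {d - norm u * B .. M}"
      using * by auto
    then show ?thesis
      by (rule bounded_subset[rotated]) (intro bounded_Times bounded_cball bounded_closed_interval)
  qed
  ultimately have "compact K" by (simp add: compact_eq_bounded_closed)
  moreover have z0: "(t0, r0) \<in> K" using ne by (simp add: K_def M_def)
  moreover have "continuous_on K F" using contF by (rule continuous_on_subset) simp
  ultimately obtain z where z: "z \<in> K" "\<And>w. w \<in> K \<Longrightarrow> F z \<le> F w"
    using continuous_attains_inf[of K F] by blast
  have min: "F z \<le> F w" if "w \<in> C" for w
  proof (cases "F w \<le> M")
    case True
    then show ?thesis using z(2) that by (simp add: K_def)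
  next
    case False
    then show ?thesis using z(1) by (simp add: K_def)
  qed
  show ?thesis
  proof (rule that)
    show "(fst z, snd z) \<in> C" using z(1) by (simp add: K_def)
    show "snd z + 1/2 * (norm (fst z - b))\<^sup>2 \<le> c + 1/2 * (norm (s - b))\<^sup>2"
      if "(s, c) \<in> C" for s c
      using min[OF that] by (simp add: F_def)
  qed
qed

text \<open>The hard half of Minty's theorem for subdifferentials of arbitrary extended-valued
  functions. The proximal problem of \<open>h\<close> itself may have no solution, so it is solved for the
  supremum of the affine minorants that touch \<open>h\<close>. The optimality condition at the solution
  \<open>(t, r)\<close>, added to a subgradient inequality of \<open>h\<close> at \<open>s\<close>, cancels the function values and
  leaves the monotonicity inequality between \<open>(t, b - t)\<close> and the graph of \<open>\<partial>h\<close>.\<close>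

lemma subdiff_resolvent_exists:
  fixes h :: "'a::euclidean_space \<Rightarrow> ereal"
  assumes max: "maximally_monotone (subdiff h)"
  shows "\<exists>t. b - t \<in> subdiff h t"
proof -
  \<comment> \<open>\<open>E\<close> is the epigraph of that supremum.\<close>
  define E where "E = {(t, r). \<forall>s u c. u \<in> subdiff h s \<and> h s = ereal c \<longrightarrow> c + u \<bullet> (t - s) \<le> r}"
  have E_eq: "E = (\<Inter>(s, u, c) \<in> {(s, u, c). u \<in> subdiff h s \<and> h s = ereal c}.
      {z. c + u \<bullet> (fst z - s) \<le> snd z})"
    by (auto simp: E_def)
  have "closed E"
    unfolding E_eq
    by (intro closed_INT ballI) (auto intro!: closed_Collect_le continuous_intros)
  have "convex E"
    unfolding E_eq
  proof (intro convex_INT, clarify)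
    fix s u :: 'a and c :: real
    have "{z. c + u \<bullet> (fst z - s) \<le> snd z} = {z. (u, - 1 :: real) \<bullet> z \<le> u \<bullet> s - c}"
      by (auto simp: inner_prod_def inner_diff_right)
    then show "convex {z. c + u \<bullet> (fst z - s) \<le> snd z}"
      by (simp add: convex_halfspace_le)
  qed
  have touch: "(s, c) \<in> E" if "h s = ereal c" for s c
    unfolding E_def
  proof (clarify)
    fix s' u c' assume "u \<in> subdiff h s'" "h s' = ereal c'"
    then have "ereal (c' + u \<bullet> (s - s')) \<le> h s" by (auto simp: subdiff_iff)
    then show "c' + u \<bullet> (s - s') \<le> c" using that by simp
  qed
  \<comment> \<open>The empty operator is not maximal, so \<open>h\<close> has a subgradient somewhere; this is what
    provides both a point of \<open>E\<close> and an affine lower bound.\<close>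
  obtain s0 u0 where u0: "u0 \<in> subdiff h s0"
    using maximally_monotone_related_mem[OF max] by blast
  then obtain c0 where c0: "h s0 = ereal c0" by (auto simp: subdiff_iff)
  have "c0 - u0 \<bullet> s0 + u0 \<bullet> t \<le> r" if "(t, r) \<in> E" for t r
  proof -
    have "c0 + u0 \<bullet> (t - s0) \<le> r" using that u0 c0 unfolding E_def by blast
    then show ?thesis by (simp add: inner_diff_right)
  qed
  then obtain t r where tr: "(t, r) \<in> E"
    and min: "\<And>s c. (s, c) \<in> E \<Longrightarrow>
      r + 1/2 * (norm (t - b))\<^sup>2 \<le> c + 1/2 * (norm (s - b))\<^sup>2"
    using prox_minimizer_exists[OF \<open>closed E\<close> touch[OF c0]] by blast
  have "(b - t - u) \<bullet> (t - s) \<ge> 0" if u: "u \<in> subdiff h s" for s u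
  proof -
    obtain c where c: "h s = ereal c" using u by (auto simp: subdiff_iff)
    have "r + (b - t) \<bullet> (s - t) \<le> c"
      by (rule prox_first_order[OF \<open>convex E\<close> tr touch[OF c] min])
    moreover have "c + u \<bullet> (t - s) \<le> r" using tr u c by (auto simp: E_def)
    ultimately show ?thesis by (simp add: inner_diff)
  qed
  then have "b - t \<in> subdiff h t" by (rule maximally_monotone_related_mem[OF max])
  then show ?thesis ..
qed

section \<open>Infimal postcomposition\<close>

lemma infimal_postcomp_le: "(A \<triangleright> f) (A *v x) \<le> f x"
  unfolding infimal_postcomp_def by (rule INF_lower) simp

text \<open>The optimality condition is applied to the image of the epigraph of \<open>f\<close> under
  \<open>(x, r) \<mapsto> (A x, r)\<close> rather than to the epigraph of \<open>A \<triangleright> f\<close>: the image is convex as a linear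
  image, and its points come with an actual point of the fibre, whereas the infimum in
  \<open>A \<triangleright> f\<close> need not be attained. The result is the affine minorant
  \<open>y \<mapsto> f(x) + (b - A x) \<bullet> (A y - A x)\<close> of \<open>f\<close>, which is constant on the fibres of \<open>A\<close>; the
  infimum over each fibre gives both conclusions.\<close>

lemma subdiff_infimal_postcomp_minimizer:
  fixes f :: "real^'n \<Rightarrow> ereal" and A :: "real^'n^'m"
  assumes proper: "proper_fun f" and conv: "convex_fun f"
    and min: "x \<in> minimizers (\<lambda>x. f x + ereal (1/2 * (norm (A *v x - b))\<^sup>2))"
  shows "f x = (A \<triangleright> f) (A *v x)" "b - A *v x \<in> subdiff (A \<triangleright> f) (A *v x)"
proof -
  have le: "f x + ereal (1/2 * (norm (A *v x - b))\<^sup>2)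
      \<le> f y + ereal (1/2 * (norm (A *v y - b))\<^sup>2)" for y
    using min by (auto simp: minimizers_def)
  obtain y where "f y \<noteq> \<infinity>" "f x \<noteq> - \<infinity>" using proper by (auto simp: proper_fun_def)
  with le[of y] obtain c where c: "f x = ereal c" by (cases "f x"; cases "f y") auto
  define g where "g = (\<lambda>z. (A *v fst z, snd z :: real))"
  define C where "C = g ` ereal_epigraph f"
  have "linear g"
    unfolding g_def
    by (intro linearI)
      (auto simp: matrix_vector_right_distrib matrix_vector_mult_scaleR)
  then have "convex C"
    unfolding C_def using conv by (auto simp: convex_fun_def intro: convex_linear_image)
  have C: "(A *v y, d) \<in> C" if "f y \<le> ereal d" for y d
    unfolding C_def g_def using that by (force simp: ereal_epigraph_def)
  have minC: "c + 1/2 * (norm (A *v x - b))\<^sup>2 \<le> d + 1/2 * (norm (s - b))\<^sup>2"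
    if sd: "(s, d) \<in> C" for s d
  proof -
    obtain y where y: "s = A *v y" "f y \<le> ereal d"
      using sd by (auto simp: C_def g_def ereal_epigraph_def)
    have "f x + ereal (1/2 * (norm (A *v x - b))\<^sup>2) \<le> ereal d + ereal (1/2 * (norm (s - b))\<^sup>2)"
      using le[of y] add_right_mono[OF y(2)] y(1) order_trans by blast
    then show ?thesis by (simp add: c)
  qed
  have supp: "ereal (c + (b - A *v x) \<bullet> (A *v y - A *v x)) \<le> f y" for y
  proof (rule ereal_le_real)
    fix d assume "f y \<le> ereal d"
    then have "c + (b - A *v x) \<bullet> (A *v y - A *v x) \<le> d"
      using prox_first_order[OF \<open>convex C\<close> C C minC] c by simp
    then show "ereal (c + (b - A *v x) \<bullet> (A *v y - A *v x)) \<le> ereal d" by simp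
  qed
  have lower: "ereal (c + (b - A *v x) \<bullet> (s - A *v x)) \<le> (A \<triangleright> f) s" for s
    unfolding infimal_postcomp_def using supp by (auto intro!: INF_greatest)
  have "ereal c \<le> (A \<triangleright> f) (A *v x)" using lower[of "A *v x"] by simp
  then show eq: "f x = (A \<triangleright> f) (A *v x)"
    using infimal_postcomp_le[of A f x] c by (simp add: antisym)
  show "b - A *v x \<in> subdiff (A \<triangleright> f) (A *v x)"
    unfolding subdiff_iff using lower eq c by (intro exI[of _ c]) auto
qed

text \<open>The subgradient inequality at \<open>A x\<close>, with \<open>1/2 \<parallel>s - b\<parallel>\<^sup>2\<close> added to both sides, is a
  complete square: it shows that moving from \<open>A x\<close> to \<open>s\<close> raises the objective by at least
  \<open>1/2 \<parallel>s - A x\<parallel>\<^sup>2\<close>. Since \<open>x\<close> attains the infimum over its fibre, this passes from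
  \<open>A \<triangleright> f\<close> to \<open>f\<close>.\<close>

lemma minimizer_if_subdiff_infimal_postcomp:
  fixes f :: "real^'n \<Rightarrow> ereal" and A :: "real^'n^'m"
  assumes sub: "b - A *v x \<in> subdiff (A \<triangleright> f) (A *v x)" and eq: "f x = (A \<triangleright> f) (A *v x)"
  shows "x \<in> minimizers (\<lambda>x. f x + ereal (1/2 * (norm (A *v x - b))\<^sup>2))"
  unfolding minimizers_def
proof (intro CollectI allI)
  fix y
  define t where "t = A *v x"
  define s where "s = A *v y"
  obtain c where c: "f x = ereal c" "\<And>s. ereal (c + (b - t) \<bullet> (s - t)) \<le> (A \<triangleright> f) s"
    using sub eq by (auto simp: subdiff_iff t_def)
  have "(b - t) \<bullet> (s - t) + 1/2 * (norm (s - b))\<^sup>2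
      = 1/2 * (norm (t - b))\<^sup>2 + 1/2 * (norm (s - t))\<^sup>2"
    by (simp only: power2_norm_eq_inner)
      (simp add: inner_diff inner_commute algebra_simps)
  then have "c + 1/2 * (norm (t - b))\<^sup>2 \<le> c + (b - t) \<bullet> (s - t) + 1/2 * (norm (s - b))\<^sup>2"
    using zero_le_power2[of "norm (s - t)"] by linarith
  then have "f x + ereal (1/2 * (norm (t - b))\<^sup>2)
      \<le> ereal (c + (b - t) \<bullet> (s - t)) + ereal (1/2 * (norm (s - b))\<^sup>2)"
    by (simp add: c(1))
  also have "\<dots> \<le> f y + ereal (1/2 * (norm (s - b))\<^sup>2)"
    using order_trans[OF c(2)[of s] infimal_postcomp_le[of A f y, folded s_def]]
    by (rule add_right_mono)
  finally show "f x + ereal (1/2 * (norm (A *v x - b))\<^sup>2)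
      \<le> f y + ereal (1/2 * (norm (A *v y - b))\<^sup>2)"
    by (simp add: t_def s_def)
qed

theorem theorem3p12:
  fixes f :: "real^'n \<Rightarrow> ereal" and A :: "real^'n^'m"
  assumes "proper_fun f" and "lsc_fun f" and "convex_fun f"
  shows "(\<forall>b :: real^'m. minimizers (\<lambda>x. f x + ereal (1/2 * (norm (A *v x - b))\<^sup>2)) \<noteq> {}) \<longleftrightarrow>
    maximally_monotone (subdiff (A \<triangleright> f)) \<and> exact_in A f (op_dom (subdiff (A \<triangleright> f)))"
proof (intro iffI conjI allI)
  assume *: "\<forall>b :: real^'m. minimizers (\<lambda>x. f x + ereal (1/2 * (norm (A *v x - b))\<^sup>2)) \<noteq> {}"
  have ex: "\<exists>x. f x = (A \<triangleright> f) (A *v x) \<and> b - A *v x \<in> subdiff (A \<triangleright> f) (A *v x)" for b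
  proof -
    obtain x where "x \<in> minimizers (\<lambda>x. f x + ereal (1/2 * (norm (A *v x - b))\<^sup>2))"
      using *[rule_format, of b] unfolding ex_in_conv[symmetric] ..
    then show ?thesis
      using subdiff_infimal_postcomp_minimizer[OF assms(1,3)] by blast
  qed
  then show "maximally_monotone (subdiff (A \<triangleright> f))"
    by (intro maximally_monotone_if_resolvent_total monotone_op_subdiff) blast
  show "exact_in A f (op_dom (subdiff (A \<triangleright> f)))"
    unfolding exact_in_def
  proof
    fix t assume "t \<in> op_dom (subdiff (A \<triangleright> f))"
    then obtain u where "u \<in> subdiff (A \<triangleright> f) t" by (auto simp: op_dom_def)
    then have "(t + u) - t \<in> subdiff (A \<triangleright> f) t" by simp
    moreover obtain x where x: "f x = (A \<triangleright> f) (A *v x)"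
      "(t + u) - A *v x \<in> subdiff (A \<triangleright> f) (A *v x)"
      using ex by blast
    ultimately have "A *v x = t"
      using monotone_op_resolvent_unique[OF monotone_op_subdiff] by blast
    then show "exact_at A f t" using x by (auto simp: exact_at_def)
  qed
next
  fix b :: "real^'m"
  assume *: "maximally_monotone (subdiff (A \<triangleright> f)) \<and> exact_in A f (op_dom (subdiff (A \<triangleright> f)))"
  then obtain t where t: "b - t \<in> subdiff (A \<triangleright> f) t"
    using subdiff_resolvent_exists by blast
  then obtain x where "A *v x = t" "f x = (A \<triangleright> f) t"
    using * unfolding exact_in_def exact_at_def op_dom_def by blast
  then have "x \<in> minimizers (\<lambda>x. f x + ereal (1/2 * (norm (A *v x - b))\<^sup>2))"
    using t by (intro minimizer_if_subdiff_infimal_postcomp) auto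
  then show "minimizers (\<lambda>x. f x + ereal (1/2 * (norm (A *v x - b))\<^sup>2)) \<noteq> {}" by blast
qed

end
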